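(* There exist quantum channels $\Lambda$ and $\Phi$ such that $\Lambda$ provides no advantage under the action of the quantum switch (that is, $\Lambda$ is entanglement breaking and both branches $C_{+,\Lambda,\Lambda}$ and $C_{-,\Lambda,\Lambda}$ are entanglement breaking CP maps), but the concatenated channel $\Phi\circ\Lambda$ is useful under the action of the quantum switch (that is, at least one of the branches $C_{+,\Phi\circ\Lambda,\Phi\circ\Lambda}$, $C_{-,\Phi\circ\Lambda,\Phi\circ\Lambda}$ is not an entanglement breaking CP map).
   Context: A quantum channel is a completely positive trace-preserving linear map on operators on a finite-dimensional Hilbert space. For a channel $\Lambda$ with Kraus operators $\{\mathcal{A}_x\}$, the quantum switch applied to two copies of $\Lambda$ with control qubit state $\omega$ has Kraus operators $\mathcal{A}_x\mathcal{A}_y\otimes|0\rangle\langle 0|+\mathcal{A}_y\mathcal{A}_x\otimes|1\rangle\langle 1|$ and yields $$\mathsf{S}_{\Lambda,\Lambda,\omega}(\rho)=C_{+,\Lambda,\Lambda}(\rho)\otimes\omega+C_{-,\Lambda,\Lambda}(\rho)\otimes\sigma_z\omega\sigma_z,$$ where the branches are the CP maps $C_{+,\Lambda,\Lambda}(\rho)=\frac14\sum_{x,y}\{\mathcal{A}_x,\mathcal{A}_y\}\rho\{\mathcal{A}_x,\mathcal{A}_y\}^\dagger$ and $C_{-,\Lambda,\Lambda}(\rho)=\frac14\sum_{x,y}[\mathcal{A}_x,\mathcal{A}_y]\rho[\mathcal{A}_x,\mathcal{A}_y]^\dagger$. A CP linear map is entanglement breaking (EB) if its Choi matrix is separable, i.e.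 a finite sum of tensor products of positive semidefinite operators (the zero map counts as EB). A channel is an entanglement breaking channel (EBC) if it is an EB CP map. Usefulness here refers to the transfer of entanglement: a channel is useless if it is an EBC, and a useless channel remains useless under the switch (is completely useless) if both of its branches are EB CP maps. *)

theory Defs
  imports Complex_Main "Jordan_Normal_Form.Schur_Decomposition"
begin

text \<open>Operators on a Hilbert space of dimension \<open>d\<close> are the matrices in \<open>carrier_mat d d\<close>.
  A map \<open>complex mat \<Rightarrow> complex mat\<close> represents a linear map on these operators; its values outside
  \<open>carrier_mat d d\<close> are irrelevant.\<close>

subsection \<open>Operators\<close>

definition mat_trace :: "complex mat \<Rightarrow> complex" where
  "mat_trace A = (\<Sum>i<dim_row A. A $$ (i, i))"

text \<open>The order on \<open>complex\<close> is the one of \<open>HOL-Library.Complex_Order\<close>, so \<open>0 \<le> z\<close> says that \<open>z\<close> is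
  real and nonnegative.\<close>

definition psd :: "nat \<Rightarrow> complex mat \<Rightarrow> bool" where
  "psd n A \<longleftrightarrow> A \<in> carrier_mat n n \<and> (\<forall>v \<in> carrier_vec n. 0 \<le> (A *\<^sub>v v) \<bullet>c v)"

definition kron :: "complex mat \<Rightarrow> complex mat \<Rightarrow> complex mat" where
  "kron A B = mat (dim_row A * dim_row B) (dim_col A * dim_col B)
     (\<lambda>(i, j). A $$ (i div dim_row B, j div dim_col B) * B $$ (i mod dim_row B, j mod dim_col B))"

text \<open>Sum of a family of \<open>n\<close>-by-\<open>n\<close> matrices (the type of matrices has no zero, hence no
  \<open>sum\<close>).\<close>

definition msum :: "nat \<Rightarrow> ('a \<Rightarrow> complex mat) \<Rightarrow> 'a set \<Rightarrow> complex mat" where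
  "msum n f S = mat n n (\<lambda>(i, j). \<Sum>x\<in>S. f x $$ (i, j))"

definition mat_basis :: "nat \<Rightarrow> nat \<Rightarrow> nat \<Rightarrow> complex mat" where
  "mat_basis d k l = mat d d (\<lambda>(i, j). if i = k \<and> j = l then 1 else 0)"

subsection \<open>Quantum channels\<close>

definition linear_map :: "nat \<Rightarrow> (complex mat \<Rightarrow> complex mat) \<Rightarrow> bool" where
  "linear_map d \<Lambda> \<longleftrightarrow>
     (\<forall>A \<in> carrier_mat d d. \<Lambda> A \<in> carrier_mat d d) \<and>
     (\<forall>A \<in> carrier_mat d d. \<forall>B \<in> carrier_mat d d. \<Lambda> (A + B) = \<Lambda> A + \<Lambda> B) \<and>
     (\<forall>c. \<forall>A \<in> carrier_mat d d. \<Lambda> (c \<cdot>\<^sub>m A) = c \<cdot>\<^sub>m \<Lambda> A)"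

text \<open>The \<open>d\<close>-by-\<open>d\<close> block \<open>(a, b)\<close> of a matrix, and the map \<open>id\<^sub>k \<otimes> \<Lambda>\<close>, which applies \<open>\<Lambda>\<close> to
  every block (same index convention as \<open>kron\<close>).\<close>

definition mat_block :: "nat \<Rightarrow> complex mat \<Rightarrow> nat \<Rightarrow> nat \<Rightarrow> complex mat" where
  "mat_block d X a b = mat d d (\<lambda>(i, j). X $$ (a * d + i, b * d + j))"

definition id_tensor :: "nat \<Rightarrow> nat \<Rightarrow> (complex mat \<Rightarrow> complex mat) \<Rightarrow> complex mat \<Rightarrow> complex mat" where
  "id_tensor k d \<Lambda> X = mat (k * d) (k * d)
     (\<lambda>(r, c). \<Lambda> (mat_block d X (r div d) (c div d)) $$ (r mod d, c mod d))"

definition cp_map :: "nat \<Rightarrow> (complex mat \<Rightarrow> complex mat) \<Rightarrow> bool" where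
  "cp_map d \<Lambda> \<longleftrightarrow> linear_map d \<Lambda> \<and> (\<forall>k X. psd (k * d) X \<longrightarrow> psd (k * d) (id_tensor k d \<Lambda> X))"

definition trace_preserving :: "nat \<Rightarrow> (complex mat \<Rightarrow> complex mat) \<Rightarrow> bool" where
  "trace_preserving d \<Lambda> \<longleftrightarrow> (\<forall>A \<in> carrier_mat d d. mat_trace (\<Lambda> A) = mat_trace A)"

definition quantum_channel :: "nat \<Rightarrow> (complex mat \<Rightarrow> complex mat) \<Rightarrow> bool" where
  "quantum_channel d \<Lambda> \<longleftrightarrow> cp_map d \<Lambda> \<and> trace_preserving d \<Lambda>"

subsection \<open>Entanglement breaking maps\<close>

definition choi :: "nat \<Rightarrow> (complex mat \<Rightarrow> complex mat) \<Rightarrow> complex mat" where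
  "choi d \<Lambda> = msum (d * d) (\<lambda>(k, l). kron (mat_basis d k l) (\<Lambda> (mat_basis d k l)))
                ({..<d} \<times> {..<d})"

text \<open>The index set may be empty (\<open>m = 0\<close>), so the zero matrix is separable.\<close>

definition separable :: "nat \<Rightarrow> complex mat \<Rightarrow> bool" where
  "separable d M \<longleftrightarrow>
     (\<exists>(m::nat) P Q. (\<forall>i<m. psd d (P i) \<and> psd d (Q i)) \<and>
        M = msum (d * d) (\<lambda>i. kron (P i) (Q i)) {..<m})"

definition eb_cp_map :: "nat \<Rightarrow> (complex mat \<Rightarrow> complex mat) \<Rightarrow> bool" where
  "eb_cp_map d \<Lambda> \<longleftrightarrow> cp_map d \<Lambda> \<and> separable d (choi d \<Lambda>)"

definition eb_channel :: "nat \<Rightarrow> (complex mat \<Rightarrow> complex mat) \<Rightarrow> bool" where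
  "eb_channel d \<Lambda> \<longleftrightarrow> quantum_channel d \<Lambda> \<and> eb_cp_map d \<Lambda>"

subsection \<open>Branches of the quantum switch\<close>

definition is_kraus :: "nat \<Rightarrow> complex mat list \<Rightarrow> (complex mat \<Rightarrow> complex mat) \<Rightarrow> bool" where
  "is_kraus d Ks \<Lambda> \<longleftrightarrow> set Ks \<subseteq> carrier_mat d d \<and>
     (\<forall>\<rho> \<in> carrier_mat d d.
        \<Lambda> \<rho> = msum d (\<lambda>x. Ks ! x * \<rho> * mat_adjoint (Ks ! x)) {..<length Ks})"

definition anticommutator :: "complex mat \<Rightarrow> complex mat \<Rightarrow> complex mat" where
  "anticommutator A B = A * B + B * A"

definition commutator :: "complex mat \<Rightarrow> complex mat \<Rightarrow> complex mat" where
  "commutator A B = A * B - B * A"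

definition kraus_plus :: "nat \<Rightarrow> complex mat list \<Rightarrow> complex mat \<Rightarrow> complex mat" where
  "kraus_plus d Ks \<rho> = (1 / 4) \<cdot>\<^sub>m msum d
     (\<lambda>(x, y). anticommutator (Ks ! x) (Ks ! y) * \<rho> * mat_adjoint (anticommutator (Ks ! x) (Ks ! y)))
     ({..<length Ks} \<times> {..<length Ks})"

definition kraus_minus :: "nat \<Rightarrow> complex mat list \<Rightarrow> complex mat \<Rightarrow> complex mat" where
  "kraus_minus d Ks \<rho> = (1 / 4) \<cdot>\<^sub>m msum d
     (\<lambda>(x, y). commutator (Ks ! x) (Ks ! y) * \<rho> * mat_adjoint (commutator (Ks ! x) (Ks ! y)))
     ({..<length Ks} \<times> {..<length Ks})"

text \<open>\<open>branch_plus d \<Lambda>\<close> and \<open>branch_minus d \<Lambda>\<close> are \<open>C\<^sub>+\<close> and \<open>C\<^sub>-\<close> for two copies of \<open>\<Lambda>\<close>. Every CP map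
  has a Kraus representation; lemma \<open>branch_eq\<close> below shows that the branches do not
  depend on which one is chosen.\<close>

definition kraus_ops :: "nat \<Rightarrow> (complex mat \<Rightarrow> complex mat) \<Rightarrow> complex mat list" where
  "kraus_ops d \<Lambda> = (SOME Ks. is_kraus d Ks \<Lambda>)"

definition branch_plus :: "nat \<Rightarrow> (complex mat \<Rightarrow> complex mat) \<Rightarrow> complex mat \<Rightarrow> complex mat" where
  "branch_plus d \<Lambda> = kraus_plus d (kraus_ops d \<Lambda>)"

definition branch_minus :: "nat \<Rightarrow> (complex mat \<Rightarrow> complex mat) \<Rightarrow> complex mat \<Rightarrow> complex mat" where
  "branch_minus d \<Lambda> = kraus_minus d (kraus_ops d \<Lambda>)"

subsection \<open>Independence of the Kraus representation\<close>

lemma mat_adjoint_carrier: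
  "A \<in> carrier_mat n m \<Longrightarrow> mat_adjoint A \<in> carrier_mat m n"
  by (auto simp: mat_adjoint_def mat_of_rows_def)

lemma mat_adjoint_index:
  assumes "A \<in> carrier_mat n m" "i < m" "j < n"
  shows "mat_adjoint A $$ (i, j) = cnj (A $$ (j, i))"
  using assms by (auto simp: mat_adjoint_def mat_of_rows_def)

lemma mult_index:
  assumes "A \<in> carrier_mat d d" "B \<in> carrier_mat d d" "i < d" "j < d"
  shows "(A * B) $$ (i, j) = (\<Sum>k<d. A $$ (i, k) * B $$ (k, j))"
  using assms by (auto simp: scalar_prod_def lessThan_atLeast0)

lemma sandwich_index:
  assumes A: "A \<in> carrier_mat d d" and r: "\<rho> \<in> carrier_mat d d" and ij: "i < d" "j < d"
  shows "(A * \<rho> * mat_adjoint A) $$ (i, j) =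
    (\<Sum>b<d. \<Sum>a<d. \<rho> $$ (a, b) * (A $$ (i, a) * cnj (A $$ (j, b))))"
proof -
  have "(A * \<rho> * mat_adjoint A) $$ (i, j) =
    (\<Sum>b<d. (A * \<rho>) $$ (i, b) * mat_adjoint A $$ (b, j))"
    using A r ij mat_adjoint_carrier[OF A] by (intro mult_index) auto
  also have "\<dots> = (\<Sum>b<d. (\<Sum>a<d. A $$ (i, a) * \<rho> $$ (a, b)) * cnj (A $$ (j, b)))"
    using A r ij by (intro sum.cong refl arg_cong2[of _ _ _ _ "(*)"] mult_index)
      (auto simp: mat_adjoint_index)
  finally show ?thesis
    by (simp add: sum_distrib_left sum_distrib_right mult_ac)
qed

definition kraus_coeff :: "complex mat list \<Rightarrow> nat \<Rightarrow> nat \<Rightarrow> nat \<Rightarrow> nat \<Rightarrow> complex" where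
  "kraus_coeff Ks i k j l = (\<Sum>x<length Ks. Ks ! x $$ (i, k) * cnj (Ks ! x $$ (j, l)))"

lemma kraus_coeff_eq:
  assumes K: "is_kraus d Ks \<Lambda>" and lt: "i < d" "j < d" "k < d" "l < d"
  shows "kraus_coeff Ks i k j l = \<Lambda> (mat_basis d k l) $$ (i, j)"
proof -
  have E: "mat_basis d k l \<in> carrier_mat d d" by (simp add: mat_basis_def)
  have "\<Lambda> (mat_basis d k l) $$ (i, j) =
    (\<Sum>x<length Ks. (Ks ! x * mat_basis d k l * mat_adjoint (Ks ! x)) $$ (i, j))"
    using K E lt by (simp add: is_kraus_def msum_def)
  also have "\<dots> = (\<Sum>x<length Ks. \<Sum>b<d. \<Sum>a<d. mat_basis d k l $$ (a, b) *
      (Ks ! x $$ (i, a) * cnj (Ks ! x $$ (j, b))))"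
    using K E lt by (intro sum.cong refl sandwich_index) (auto simp: is_kraus_def)
  also have "\<dots> = (\<Sum>x<length Ks. \<Sum>b<d. \<Sum>a<d. if b = l then
      (if a = k then Ks ! x $$ (i, a) * cnj (Ks ! x $$ (j, b)) else 0) else 0)"
    by (intro sum.cong refl) (simp add: mat_basis_def)
  also have "\<dots> = (\<Sum>x<length Ks. \<Sum>b<d. if b = l then
      (\<Sum>a<d. if a = k then Ks ! x $$ (i, a) * cnj (Ks ! x $$ (j, b)) else 0) else 0)"
    by (intro sum.cong refl) simp
  also have "\<dots> = kraus_coeff Ks i k j l"
    using lt by (simp add: kraus_coeff_def)
  finally show ?thesis by simp
qed

lemma sum_swap4:
  "(\<Sum>x\<in>A. \<Sum>y\<in>B. \<Sum>k\<in>C. \<Sum>l\<in>D. f x y k l) =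
   (\<Sum>k\<in>C. \<Sum>l\<in>D. \<Sum>x\<in>A. \<Sum>y\<in>B. f x y k l :: complex)"
proof -
  have "(\<Sum>x\<in>A. \<Sum>y\<in>B. \<Sum>k\<in>C. \<Sum>l\<in>D. f x y k l) =
    (\<Sum>x\<in>A. \<Sum>k\<in>C. \<Sum>l\<in>D. \<Sum>y\<in>B. f x y k l)"
    by (rule sum.cong[OF refl], subst sum.swap, rule sum.cong[OF refl], rule sum.swap)
  also have "\<dots> = (\<Sum>k\<in>C. \<Sum>l\<in>D. \<Sum>x\<in>A. \<Sum>y\<in>B. f x y k l)"
    by (subst sum.swap, rule sum.cong[OF refl], rule sum.swap)
  finally show ?thesis .
qed

lemma kraus_quad_expand:
  fixes s :: complex
  shows "((\<Sum>k\<in>C. p k) + s * (\<Sum>k\<in>C. q k)) * cnj ((\<Sum>l\<in>C. p' l) + s * (\<Sum>l\<in>C. q' l)) =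
    (\<Sum>k\<in>C. \<Sum>l\<in>C. (p k + s * q k) * cnj (p' l + s * q' l))"
proof -
  have "(\<Sum>k\<in>C. p k) + s * (\<Sum>k\<in>C. q k) = (\<Sum>k\<in>C. p k + s * q k)"
    "(\<Sum>l\<in>C. p' l) + s * (\<Sum>l\<in>C. q' l) = (\<Sum>l\<in>C. p' l + s * q' l)"
    by (simp_all only: sum.distrib sum_distrib_left)
  then show ?thesis by (simp only: cnj_sum sum_product)
qed

lemma kraus_quad_collect:
  fixes s :: complex
  shows "(\<Sum>x\<in>A. \<Sum>y\<in>B. f1 x * g1 y + s * (f2 x * g2 y) + s * (f3 x * g3 y) + s * s * (f4 x * g4 y)) =
    sum f1 A * sum g1 B + s * (sum f2 A * sum g2 B) + s * (sum f3 A * sum g3 B)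
      + s * s * (sum f4 A * sum g4 B)"
  unfolding sum_product sum.distrib by (simp only: sum_distrib_left)

lemma kraus_quad:
  fixes s :: complex
  assumes K: "set Ks \<subseteq> carrier_mat d d" and lt: "i < d" "j < d" "a < d" "b < d"
    and s: "cnj s = s"
  defines "T \<equiv> kraus_coeff Ks"
  shows "(\<Sum>(x, y)\<in>{..<length Ks} \<times> {..<length Ks}.
      ((Ks ! x * Ks ! y) $$ (i, a) + s * (Ks ! y * Ks ! x) $$ (i, a)) *
      cnj ((Ks ! x * Ks ! y) $$ (j, b) + s * (Ks ! y * Ks ! x) $$ (j, b))) =
    (\<Sum>k<d. \<Sum>l<d. T i k j l * T k a l b + s * (T i k l b * T k a j l)
      + s * (T k a j l * T i k l b) + s * s * (T k a l b * T i k j l))"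
proof -
  let ?n = "length Ks"
  define A where "A x = (($$) (Ks ! x))" for x
  have m: "(Ks ! x * Ks ! y) $$ (i, j) = (\<Sum>k<d. A x (i, k) * A y (k, j))"
    if "x < ?n" "y < ?n" "i < d" "j < d" for x y i j
    unfolding A_def using that K by (intro mult_index) auto
  have "(\<Sum>(x, y)\<in>{..<?n} \<times> {..<?n}.
      ((Ks ! x * Ks ! y) $$ (i, a) + s * (Ks ! y * Ks ! x) $$ (i, a)) *
      cnj ((Ks ! x * Ks ! y) $$ (j, b) + s * (Ks ! y * Ks ! x) $$ (j, b))) =
    (\<Sum>x<?n. \<Sum>y<?n. \<Sum>k<d. \<Sum>l<d.
      (A x (i, k) * A y (k, a) + s * (A y (i, k) * A x (k, a))) *
      cnj (A x (j, l) * A y (l, b) + s * (A y (j, l) * A x (l, b))))"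
    unfolding sum.cartesian_product[symmetric]
    by (intro sum.cong refl)
      (simp only: m lt lessThan_iff kraus_quad_expand)
  also have "\<dots> = (\<Sum>k<d. \<Sum>l<d. \<Sum>x<?n. \<Sum>y<?n.
      (A x (i, k) * A y (k, a) + s * (A y (i, k) * A x (k, a))) *
      cnj (A x (j, l) * A y (l, b) + s * (A y (j, l) * A x (l, b))))"
    by (rule sum_swap4)
  also have "\<dots> = (\<Sum>k<d. \<Sum>l<d. \<Sum>x<?n. \<Sum>y<?n.
      (A x (i, k) * cnj (A x (j, l))) * (A y (k, a) * cnj (A y (l, b)))
      + s * ((A x (i, k) * cnj (A x (l, b))) * (A y (k, a) * cnj (A y (j, l))))
      + s * ((A x (k, a) * cnj (A x (j, l))) * (A y (i, k) * cnj (A y (l, b))))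
      + s * s * ((A x (k, a) * cnj (A x (l, b))) * (A y (i, k) * cnj (A y (j, l)))))"
    by (intro sum.cong refl) (simp add: s algebra_simps)
  also have "\<dots> = (\<Sum>k<d. \<Sum>l<d. T i k j l * T k a l b + s * (T i k l b * T k a j l)
      + s * (T k a j l * T i k l b) + s * s * (T k a l b * T i k j l))"
    unfolding T_def kraus_coeff_def A_def by (simp only: kraus_quad_collect)
  finally show ?thesis .
qed

lemma kraus_quad_cong:
  fixes s :: complex
  assumes K: "is_kraus d Ks \<Lambda>" and K': "is_kraus d Ks' \<Lambda>"
    and lt: "i < d" "j < d" "a < d" "b < d" and s: "cnj s = s"
  shows "(\<Sum>(x, y)\<in>{..<length Ks} \<times> {..<length Ks}.
      ((Ks ! x * Ks ! y) $$ (i, a) + s * (Ks ! y * Ks ! x) $$ (i, a)) *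
      cnj ((Ks ! x * Ks ! y) $$ (j, b) + s * (Ks ! y * Ks ! x) $$ (j, b))) =
    (\<Sum>(x, y)\<in>{..<length Ks'} \<times> {..<length Ks'}.
      ((Ks' ! x * Ks' ! y) $$ (i, a) + s * (Ks' ! y * Ks' ! x) $$ (i, a)) *
      cnj ((Ks' ! x * Ks' ! y) $$ (j, b) + s * (Ks' ! y * Ks' ! x) $$ (j, b)))"
proof -
  have c: "set Ks \<subseteq> carrier_mat d d" "set Ks' \<subseteq> carrier_mat d d"
    using K K' by (auto simp: is_kraus_def)
  show ?thesis
    unfolding kraus_quad[OF c(1) lt s] kraus_quad[OF c(2) lt s]
    by (intro sum.cong refl) (simp add: kraus_coeff_eq[OF K] kraus_coeff_eq[OF K'] lt)
qed

lemma sandwich_sum_index: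
  assumes M: "\<And>x y. x < n \<Longrightarrow> y < n \<Longrightarrow> M x y \<in> carrier_mat d d"
    and r: "\<rho> \<in> carrier_mat d d" and ij: "i < d" "j < d"
  shows "msum d (\<lambda>(x, y). M x y * \<rho> * mat_adjoint (M x y)) ({..<n} \<times> {..<n}) $$ (i, j) =
    (\<Sum>b<d. \<Sum>a<d. \<rho> $$ (a, b) *
      (\<Sum>(x, y)\<in>{..<n} \<times> {..<n}. M x y $$ (i, a) * cnj (M x y $$ (j, b))))"
proof -
  have "msum d (\<lambda>(x, y). M x y * \<rho> * mat_adjoint (M x y)) ({..<n} \<times> {..<n}) $$ (i, j) =
    (\<Sum>p\<in>{..<n} \<times> {..<n}. \<Sum>b<d. \<Sum>a<d.
      \<rho> $$ (a, b) * (M (fst p) (snd p) $$ (i, a) * cnj (M (fst p) (snd p) $$ (j, b))))"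
    using ij by (auto simp: msum_def sandwich_index[OF M r] intro!: sum.cong)
  also have "\<dots> = (\<Sum>b<d. \<Sum>a<d. \<Sum>p\<in>{..<n} \<times> {..<n}.
      \<rho> $$ (a, b) * (M (fst p) (snd p) $$ (i, a) * cnj (M (fst p) (snd p) $$ (j, b))))"
    by (subst sum.swap, rule sum.cong[OF refl], rule sum.swap)
  finally show ?thesis by (simp add: sum_distrib_left case_prod_beta)
qed

lemma kraus_branch_cong:
  fixes s :: complex
  assumes K: "is_kraus d Ks \<Lambda>" and K': "is_kraus d Ks' \<Lambda>" and r: "\<rho> \<in> carrier_mat d d"
    and s: "cnj s = s"
    and F: "\<And>A B. A \<in> carrier_mat d d \<Longrightarrow> B \<in> carrier_mat d d \<Longrightarrow> F A B \<in> carrier_mat d d"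
    and F': "\<And>A B i j. A \<in> carrier_mat d d \<Longrightarrow> B \<in> carrier_mat d d \<Longrightarrow> i < d \<Longrightarrow> j < d \<Longrightarrow>
      F A B $$ (i, j) = (A * B) $$ (i, j) + s * (B * A) $$ (i, j)"
  shows "msum d (\<lambda>(x, y). F (Ks ! x) (Ks ! y) * \<rho> * mat_adjoint (F (Ks ! x) (Ks ! y)))
      ({..<length Ks} \<times> {..<length Ks}) =
    msum d (\<lambda>(x, y). F (Ks' ! x) (Ks' ! y) * \<rho> * mat_adjoint (F (Ks' ! x) (Ks' ! y)))
      ({..<length Ks'} \<times> {..<length Ks'})" (is "?S Ks = ?S Ks'")
proof (rule eq_matI)
  define Q where "Q L i j a b = (\<Sum>(x, y)\<in>{..<length L} \<times> {..<length L}.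
      ((L ! x * L ! y) $$ (i, a) + s * (L ! y * L ! x) $$ (i, a)) *
      cnj ((L ! x * L ! y) $$ (j, b) + s * (L ! y * L ! x) $$ (j, b)))"
    for L :: "complex mat list" and i j a b
  have e: "?S L $$ (i, j) = (\<Sum>b<d. \<Sum>a<d. \<rho> $$ (a, b) * Q L i j a b)"
    if L: "is_kraus d L \<Lambda>" and ij: "i < d" "j < d" for L i j
  proof -
    have c: "L ! x \<in> carrier_mat d d" if "x < length L" for x
      using L that by (auto simp: is_kraus_def)
    have "?S L $$ (i, j) = (\<Sum>b<d. \<Sum>a<d. \<rho> $$ (a, b) *
      (\<Sum>(x, y)\<in>{..<length L} \<times> {..<length L}.
        F (L ! x) (L ! y) $$ (i, a) * cnj (F (L ! x) (L ! y) $$ (j, b))))"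
      by (rule sandwich_sum_index[OF _ r ij]) (intro F c)
    also have "\<dots> = (\<Sum>b<d. \<Sum>a<d. \<rho> $$ (a, b) * Q L i j a b)"
      unfolding Q_def
    proof (intro sum.cong refl arg_cong2[of _ _ _ _ "(*)"], clarify)
      fix a b x y assume "a < d" "b < d" "x < length L" "y < length L"
      then show "F (L ! x) (L ! y) $$ (i, a) * cnj (F (L ! x) (L ! y) $$ (j, b)) =
        ((L ! x * L ! y) $$ (i, a) + s * (L ! y * L ! x) $$ (i, a)) *
        cnj ((L ! x * L ! y) $$ (j, b) + s * (L ! y * L ! x) $$ (j, b))"
        by (simp only: F'[OF c c] ij)
    qed
    finally show ?thesis .
  qed
  have q: "Q Ks i j a b = Q Ks' i j a b" if "i < d" "j < d" "a < d" "b < d" for i j a b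
    unfolding Q_def by (rule kraus_quad_cong[OF K K' that s])
  show "?S Ks $$ (i, j) = ?S Ks' $$ (i, j)" if "i < dim_row (?S Ks')" "j < dim_col (?S Ks')" for i j
  proof -
    have ij: "i < d" "j < d" using that by (simp_all add: msum_def)
    show ?thesis
      unfolding e[OF K ij] e[OF K' ij] by (intro sum.cong refl) (simp add: q ij)
  qed
qed (simp_all add: msum_def)

lemma branch_eq:
  assumes K: "is_kraus d Ks \<Lambda>" and r: "\<rho> \<in> carrier_mat d d"
  shows "branch_plus d \<Lambda> \<rho> = kraus_plus d Ks \<rho>"
    and "branch_minus d \<Lambda> \<rho> = kraus_minus d Ks \<rho>"
proof -
  have K': "is_kraus d (kraus_ops d \<Lambda>) \<Lambda>"
    unfolding kraus_ops_def using K by (rule someI)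
  show "branch_plus d \<Lambda> \<rho> = kraus_plus d Ks \<rho>"
    unfolding branch_plus_def kraus_plus_def
    by (rule arg_cong[OF kraus_branch_cong[OF K' K r, where s = 1]]) (auto simp: anticommutator_def)
  show "branch_minus d \<Lambda> \<rho> = kraus_minus d Ks \<rho>"
    unfolding branch_minus_def kraus_minus_def
    by (rule arg_cong[OF kraus_branch_cong[OF K' K r, where s = "-1"]]) (auto simp: commutator_def)
qed

end

theory Submission
  imports Defs
begin

text \<open>Take the qubit dephasing channel, with Kraus operators \<open>|0><0|\<close> and \<open>|1><1|\<close>. These commute and
  multiply to zero, so \<open>C\<^sub>+\<close> is the dephasing channel again and \<open>C\<^sub>-\<close> vanishes. Following it by
  the bit flip gives the Kraus operators \<open>|1><0|\<close> and \<open>|0><1|\<close>, whose anticommutator is the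
  identity; now \<open>C\<^sub>+\<close> is half the identity map, whose Choi matrix is entangled.\<close>

section \<open>Positive semidefinite matrices\<close>

text \<open>Letting the test vector be an arbitrary function on indices allows unit vectors and
  their combinations to be given by case distinction. Only the values of \<open>f\<close> below
  \<open>n\<close> enter; \<open>vec n f\<close> is the corresponding vector.\<close>

lemma psd_iff:
  "psd n A \<longleftrightarrow> A \<in> carrier_mat n n \<and>
    (\<forall>f. 0 \<le> (\<Sum>i<n. \<Sum>j<n. A $$ (i, j) * f j * cnj (f i)))"
proof -
  have form: "(A *\<^sub>v v) \<bullet>c v = (\<Sum>i<n. \<Sum>j<n. A $$ (i, j) * v $ j * cnj (v $ i))"
    if "A \<in> carrier_mat n n" "v \<in> carrier_vec n" for v
    using that by (auto simp: scalar_prod_def lessThan_atLeast0 sum_distrib_right intro!: sum.cong)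
  have "0 \<le> (\<Sum>i<n. \<Sum>j<n. A $$ (i, j) * f j * cnj (f i))"
    if "psd n A" for f
  proof -
    have "0 \<le> (A *\<^sub>v vec n f) \<bullet>c vec n f"
      using that by (simp add: psd_def)
    then show ?thesis
      using that by (subst (asm) form) (auto simp: psd_def)
  qed
  then show ?thesis
    by (auto simp: psd_def form)
qed

text \<open>The quadratic form at the \<open>i\<close>-th unit vector is the \<open>i\<close>-th
  diagonal entry.\<close>

lemma psd_diag_nonneg:
  assumes "psd n A" "i < n"
  shows "0 \<le> A $$ (i, i)"
proof -
  have "0 \<le> (\<Sum>k<n. \<Sum>l<n. A $$ (k, l) * (if l = i then 1 else 0) * cnj (if k = i then 1 else 0))"
    using assms(1)[unfolded psd_iff, THEN conjunct2, THEN spec] .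
  also have "\<dots> = (\<Sum>k<n. if k = i then A $$ (i, i) else 0)"
    using assms(2) by (intro sum.cong refl) (simp add: if_distrib[of "times _"] cong: if_cong)
  also have "\<dots> = A $$ (i, i)"
    using assms(2) by simp
  finally show ?thesis .
qed

text \<open>The order makes every value real and nonnegative. An affine real function bounded below
  on the whole line is constant, so \<open>Re b\<close> vanishes; the imaginary part vanishes at
  every \<open>s\<close>, so \<open>Im b\<close> does too.\<close>

lemma affine_nonneg_imp_slope_zero:
  fixes a b :: complex
  assumes "\<And>s::real. 0 \<le> a + of_real s * b"
  shows "b = 0"
proof -
  have re: "0 \<le> Re a + s * Re b" and im: "Im a + s * Im b = 0" for s
    using assms[of s] by (auto simp: less_eq_complex_def)
  have "Re b = 0"
  proof (rule ccontr)
    assume "Re b \<noteq> 0"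
    then show False
      \<comment> \<open>At this \<open>s\<close> the real part equals -1.\<close>
      using re[of "- (Re a + 1) / Re b"] by simp
  qed
  moreover have "Im b = 0"
    using im[of 0] im[of 1] by simp
  ultimately show ?thesis
    by (simp add: complex_eq_iff)
qed

text \<open>At the vector with entry \<open>t\<close> at \<open>i\<close> and 1 at \<open>j\<close>,
  the quadratic form has no term in \<open>t * cnj t\<close>, because its coefficient is the zero
  diagonal entry. Along each real line in \<open>t\<close> it is therefore affine and nonnegative,
  so its slope is zero.\<close>

lemma psd_zero_diag:
  assumes A: "psd n A" and lt: "i < n" "j < n" and z: "A $$ (i, i) = 0"
  shows "A $$ (i, j) = 0" and "A $$ (j, i) = 0"
proof -
  have "A $$ (i, j) = 0 \<and> A $$ (j, i) = 0"
  proof (cases "i = j")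
    case False
    have form: "0 \<le> A $$ (j, j) + t * A $$ (j, i) + cnj t * A $$ (i, j)" for t
    proof -
      define f where "f k = (if k = i then t else if k = j then 1 else 0)" for k
      have "0 \<le> (\<Sum>k<n. \<Sum>l<n. A $$ (k, l) * f l * cnj (f k))"
        using A unfolding psd_iff by blast
      also have "\<dots> = (\<Sum>k\<in>{i, j}. \<Sum>l<n. A $$ (k, l) * f l * cnj (f k))"
        using lt by (intro sum.mono_neutral_right) (auto simp: f_def)
      also have "\<dots> = (\<Sum>k\<in>{i, j}. \<Sum>l\<in>{i, j}. A $$ (k, l) * f l * cnj (f k))"
        using lt by (intro sum.cong refl sum.mono_neutral_right) (auto simp: f_def)
      also have "\<dots> = A $$ (j, j) + t * A $$ (j, i) + cnj t * A $$ (i, j)"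
        using False z by (simp add: f_def)
      finally show ?thesis .
    qed
    \<comment> \<open>Real \<open>t\<close> yields the sum of the two entries and imaginary
      \<open>t\<close> their difference; together they make both entries vanish.\<close>
    have "A $$ (j, i) + A $$ (i, j) = 0"
      by (rule affine_nonneg_imp_slope_zero[where a = "A $$ (j, j)"])
        (use form[of "of_real _"] in \<open>simp add: algebra_simps\<close>)
    moreover have "\<i> * (A $$ (j, i) - A $$ (i, j)) = 0"
      by (rule affine_nonneg_imp_slope_zero[where a = "A $$ (j, j)"])
        (use form[of "\<i> * of_real _"] in \<open>simp add: algebra_simps\<close>)
    ultimately show ?thesis
      by simp
  qed (use z in simp)
  then show "A $$ (i, j) = 0" "A $$ (j, i) = 0" by simp_all
qed

section \<open>Complete positivity from a Kraus representation\<close>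

text \<open>Splits an index of the tensor product into block number and position in the block,
  following the convention of \<open>kron\<close> and \<open>id_tensor\<close>.\<close>

lemma sum_lessThan_mult:
  "(\<Sum>r<k * d. f r) = (\<Sum>a<k. \<Sum>i<d. f (a * d + i :: nat))"
proof -
  have "sum f {a * d..<a * d + d} = (\<Sum>i<d. f (a * d + i))" for a
    using sum.shift_bounds_nat_ivl[of f 0 "a * d" d] by (simp add: lessThan_atLeast0 add.commute)
  then show ?thesis
    by (simp add: sum.nat_group[symmetric])
qed

text \<open>By \<open>sandwich_index\<close>, each entry of the image is a fixed linear combination
  of the entries of the argument.\<close>

lemma is_kraus_imp_linear_map:
  assumes K: "is_kraus d Ks \<Lambda>"
  shows "linear_map d \<Lambda>"
proof -
  have c: "Ks ! x \<in> carrier_mat d d" if "x < length Ks" for x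
    using K that by (auto simp: is_kraus_def)
  have ent: "\<Lambda> A $$ (i, j) = (\<Sum>x<length Ks. \<Sum>b<d. \<Sum>a<d.
      A $$ (a, b) * (Ks ! x $$ (i, a) * cnj (Ks ! x $$ (j, b))))"
    if "A \<in> carrier_mat d d" "i < d" "j < d" for A i j
    using K that by (auto simp: is_kraus_def msum_def sandwich_index[OF c] intro!: sum.cong)
  have car: "\<Lambda> A \<in> carrier_mat d d" if "A \<in> carrier_mat d d" for A
    using K that by (simp add: is_kraus_def msum_def)
  show ?thesis
    unfolding linear_map_def
  proof (intro conjI ballI allI)
    fix A B :: "complex mat" assume AB: "A \<in> carrier_mat d d" "B \<in> carrier_mat d d"
    show "\<Lambda> (A + B) = \<Lambda> A + \<Lambda> B"
    proof (rule eq_matI)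
      fix i j assume "i < dim_row (\<Lambda> A + \<Lambda> B)" "j < dim_col (\<Lambda> A + \<Lambda> B)"
      then have ij: "i < d" "j < d"
        using car[OF AB(2)] by auto
      show "\<Lambda> (A + B) $$ (i, j) = (\<Lambda> A + \<Lambda> B) $$ (i, j)"
        using AB ij car[OF AB(1)] car[OF AB(2)]
        by (simp add: ent distrib_right sum.distrib)
    qed (use AB car[of A] car[of B] car[of "A + B"] in auto)
  next
    fix c and A :: "complex mat" assume A: "A \<in> carrier_mat d d"
    show "\<Lambda> (c \<cdot>\<^sub>m A) = c \<cdot>\<^sub>m \<Lambda> A"
    proof (rule eq_matI)
      fix i j assume "i < dim_row (c \<cdot>\<^sub>m \<Lambda> A)" "j < dim_col (c \<cdot>\<^sub>m \<Lambda> A)"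
      then have ij: "i < d" "j < d"
        using car[OF A] by auto
      show "\<Lambda> (c \<cdot>\<^sub>m A) $$ (i, j) = (c \<cdot>\<^sub>m \<Lambda> A) $$ (i, j)"
        using A ij car[OF A] by (simp add: ent sum_distrib_left mult.assoc)
    qed (use A car[of A] car[of "c \<cdot>\<^sub>m A"] in auto)
  qed (rule car)
qed

text \<open>Moving each Kraus operator \<open>K\<^sub>x\<close> onto the test vector turns the
  quadratic form of the image at \<open>f\<close> into the sum over \<open>x\<close> of the
  quadratic form of \<open>X\<close> at the adjoint of \<open>1 \<otimes> K\<^sub>x\<close> applied
  to \<open>f\<close>. Every summand is nonnegative.\<close>

lemma is_kraus_imp_cp_map:
  assumes K: "is_kraus d Ks \<Lambda>"
  shows "cp_map d \<Lambda>"
  unfolding cp_map_def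
proof (intro conjI allI impI)
  show "linear_map d \<Lambda>"
    by (rule is_kraus_imp_linear_map[OF K])
next
  fix k X assume X: "psd (k * d) X"
  let ?n = "length Ks"
  have c: "Ks ! x \<in> carrier_mat d d" if "x < ?n" for x
    using K that by (auto simp: is_kraus_def)
  have blk: "mat_block d X a b \<in> carrier_mat d d" for a b
    by (simp add: mat_block_def)
  have ent: "\<Lambda> (mat_block d X a b) $$ (i, j) = (\<Sum>x<?n. \<Sum>j'<d. \<Sum>i'<d.
      X $$ (a * d + i', b * d + j') * (Ks ! x $$ (i, i') * cnj (Ks ! x $$ (j, j'))))"
    if "i < d" "j < d" for a b i j
  proof -
    have "\<Lambda> (mat_block d X a b) $$ (i, j) =
        (\<Sum>x<?n. (Ks ! x * mat_block d X a b * mat_adjoint (Ks ! x)) $$ (i, j))"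
      using K that blk by (simp add: is_kraus_def msum_def)
    also have "\<dots> = (\<Sum>x<?n. \<Sum>j'<d. \<Sum>i'<d.
      mat_block d X a b $$ (i', j') * (Ks ! x $$ (i, i') * cnj (Ks ! x $$ (j, j'))))"
      by (intro sum.cong refl sandwich_index c blk that) simp
    finally show ?thesis
      by (simp add: mat_block_def)
  qed
  have lt: "a * d + i < k * d" if "a < k" "i < d" for a i
  proof -
    have "a * d + i < Suc a * d" using that by simp
    also have "\<dots> \<le> k * d" using that by (intro mult_le_mono1) simp
    finally show ?thesis .
  qed
  show "psd (k * d) (id_tensor k d \<Lambda> X)"
    unfolding psd_iff
  proof (intro conjI allI)
    fix f :: "nat \<Rightarrow> complex"
    \<comment> \<open>\<open>g x\<close> is the adjoint of \<open>1 \<otimes> K\<^sub>x\<close>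
      applied to \<open>f\<close>: within each block of \<open>f\<close>, the adjoint of
      \<open>Ks ! x\<close> acts.\<close>
    define g where "g x r = (\<Sum>i<d. cnj (Ks ! x $$ (i, r mod d)) * f (r div d * d + i))" for x r
    have "(\<Sum>r<k * d. \<Sum>s<k * d. id_tensor k d \<Lambda> X $$ (r, s) * f s * cnj (f r)) =
      (\<Sum>a<k. \<Sum>i<d. \<Sum>b<k. \<Sum>j<d.
        \<Lambda> (mat_block d X a b) $$ (i, j) * f (b * d + j) * cnj (f (a * d + i)))"
      unfolding sum_lessThan_mult
      by (intro sum.cong refl) (simp add: id_tensor_def lt)
    also have "\<dots> = (\<Sum>a<k. \<Sum>i<d. \<Sum>b<k. \<Sum>j<d. \<Sum>x<?n. \<Sum>j'<d. \<Sum>i'<d.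
        X $$ (a * d + i', b * d + j') * (cnj (Ks ! x $$ (j, j')) * f (b * d + j)) *
          (Ks ! x $$ (i, i') * cnj (f (a * d + i))))"
      by (intro sum.cong refl) (simp add: ent sum_distrib_left sum_distrib_right mult_ac)
    also have "\<dots> = (\<Sum>a<k. \<Sum>b<k. \<Sum>i<d. \<Sum>j<d. \<Sum>x<?n. \<Sum>j'<d. \<Sum>i'<d.
        X $$ (a * d + i', b * d + j') * (cnj (Ks ! x $$ (j, j')) * f (b * d + j)) *
          (Ks ! x $$ (i, i') * cnj (f (a * d + i))))"
      by (intro sum.cong refl sum.swap)
    also have "\<dots> = (\<Sum>a<k. \<Sum>b<k. \<Sum>x<?n. \<Sum>i'<d. \<Sum>j'<d. \<Sum>i<d. \<Sum>j<d.
        X $$ (a * d + i', b * d + j') * (cnj (Ks ! x $$ (j, j')) * f (b * d + j)) *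
          (Ks ! x $$ (i, i') * cnj (f (a * d + i))))"
    \<comment> \<open>For fixed blocks, the Kraus index moves outward and \<open>sum_swap4\<close>
      exchanges the output pair \<open>i\<close>, \<open>j\<close> with the input pair
      \<open>i'\<close>, \<open>j'\<close>. The inner sums then factor into values of
      \<open>g x\<close>.\<close>
    proof (rule sum.cong[OF refl], rule sum.cong[OF refl])
      fix a b
      let ?t = "\<lambda>i j x j' i'. X $$ (a * d + i', b * d + j') * (cnj (Ks ! x $$ (j, j')) * f (b * d + j)) *
          (Ks ! x $$ (i, i') * cnj (f (a * d + i)))"
      have "(\<Sum>i<d. \<Sum>j<d. \<Sum>x<?n. \<Sum>j'<d. \<Sum>i'<d. ?t i j x j' i') =
        (\<Sum>i<d. \<Sum>x<?n. \<Sum>j<d. \<Sum>j'<d. \<Sum>i'<d. ?t i j x j' i')"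
        by (intro sum.cong refl sum.swap)
      also have "\<dots> = (\<Sum>x<?n. \<Sum>i<d. \<Sum>j<d. \<Sum>j'<d. \<Sum>i'<d. ?t i j x j' i')"
        by (rule sum.swap)
      also have "\<dots> = (\<Sum>x<?n. \<Sum>i<d. \<Sum>j<d. \<Sum>i'<d. \<Sum>j'<d. ?t i j x j' i')"
        by (intro sum.cong refl sum.swap)
      also have "\<dots> = (\<Sum>x<?n. \<Sum>i'<d. \<Sum>j'<d. \<Sum>i<d. \<Sum>j<d. ?t i j x j' i')"
        by (intro sum.cong refl sum_swap4)
      finally show "(\<Sum>i<d. \<Sum>j<d. \<Sum>x<?n. \<Sum>j'<d. \<Sum>i'<d. ?t i j x j' i') =
        (\<Sum>x<?n. \<Sum>i'<d. \<Sum>j'<d. \<Sum>i<d. \<Sum>j<d. ?t i j x j' i')" .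
    qed
    also have "\<dots> = (\<Sum>a<k. \<Sum>b<k. \<Sum>x<?n. \<Sum>i'<d. \<Sum>j'<d.
        X $$ (a * d + i', b * d + j') * g x (b * d + j') * cnj (g x (a * d + i')))"
    proof (intro sum.cong refl)
      fix a b x i' j' assume "i' \<in> {..<d}" "j' \<in> {..<d}"
      then have "g x (b * d + j') = (\<Sum>j<d. cnj (Ks ! x $$ (j, j')) * f (b * d + j))"
        "cnj (g x (a * d + i')) = (\<Sum>i<d. Ks ! x $$ (i, i') * cnj (f (a * d + i)))"
        by (simp_all add: g_def)
      then show "(\<Sum>i<d. \<Sum>j<d. X $$ (a * d + i', b * d + j') *
          (cnj (Ks ! x $$ (j, j')) * f (b * d + j)) * (Ks ! x $$ (i, i') * cnj (f (a * d + i)))) =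
        X $$ (a * d + i', b * d + j') * g x (b * d + j') * cnj (g x (a * d + i'))"
        by (simp add: sum_distrib_left sum_distrib_right)
    qed
    also have "\<dots> = (\<Sum>a<k. \<Sum>x<?n. \<Sum>b<k. \<Sum>i'<d. \<Sum>j'<d.
        X $$ (a * d + i', b * d + j') * g x (b * d + j') * cnj (g x (a * d + i')))"
      by (intro sum.cong refl sum.swap)
    also have "\<dots> = (\<Sum>x<?n. \<Sum>a<k. \<Sum>b<k. \<Sum>i'<d. \<Sum>j'<d.
        X $$ (a * d + i', b * d + j') * g x (b * d + j') * cnj (g x (a * d + i')))"
      by (rule sum.swap)
    also have "\<dots> = (\<Sum>x<?n. \<Sum>a<k. \<Sum>i'<d. \<Sum>b<k. \<Sum>j'<d.
        X $$ (a * d + i', b * d + j') * g x (b * d + j') * cnj (g x (a * d + i')))"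
      by (intro sum.cong refl sum.swap)
    also have "\<dots> = (\<Sum>x<?n. \<Sum>r<k * d. \<Sum>s<k * d. X $$ (r, s) * g x s * cnj (g x r))"
      unfolding sum_lessThan_mult ..
    also have "0 \<le> \<dots>"
      by (rule sum_nonneg, rule X[unfolded psd_iff, THEN conjunct2, THEN spec])
    finally show "0 \<le> (\<Sum>r<k * d. \<Sum>s<k * d. id_tensor k d \<Lambda> X $$ (r, s) * f s * cnj (f r))" .
  qed (simp add: id_tensor_def)
qed

section \<open>Choi matrices and separability\<close>

lemma msum_dims [simp]:
  "msum n f S \<in> carrier_mat n n" "dim_row (msum n f S) = n" "dim_col (msum n f S) = n"
  by (simp_all add: msum_def)

lemma kron_index:
  assumes "A \<in> carrier_mat d d" "B \<in> carrier_mat d d" "r < d * d" "c < d * d"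
  shows "kron A B $$ (r, c) = A $$ (r div d, c div d) * B $$ (r mod d, c mod d)"
  using assms by (auto simp: kron_def)

lemma mat_basis_carrier [simp]: "mat_basis d k l \<in> carrier_mat d d"
  by (simp add: mat_basis_def)

text \<open>The summand for \<open>(k, l)\<close> is supported on block \<open>(k, l)\<close> alone,
  so each block of the Choi matrix is the image of one matrix unit.\<close>

lemma choi_index:
  assumes "\<And>k l. k < d \<Longrightarrow> l < d \<Longrightarrow> \<Lambda> (mat_basis d k l) \<in> carrier_mat d d"
    and "r < d * d" "c < d * d"
  shows "choi d \<Lambda> $$ (r, c) = \<Lambda> (mat_basis d (r div d) (c div d)) $$ (r mod d, c mod d)"
proof -
  have lt: "r div d < d" "c div d < d"
    using assms(2,3) by (simp_all add: less_mult_imp_div_less)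
  \<comment> \<open>Nested conditionals, one per index, let the two sums collapse one after the
    other.\<close>
  have "choi d \<Lambda> $$ (r, c) = (\<Sum>(k, l)\<in>{..<d} \<times> {..<d}.
      if k = r div d then if l = c div d
        then \<Lambda> (mat_basis d k l) $$ (r mod d, c mod d) else 0 else 0)"
  proof -
    have "kron (mat_basis d k l) (\<Lambda> (mat_basis d k l)) $$ (r, c) =
      (if k = r div d then if l = c div d
        then \<Lambda> (mat_basis d k l) $$ (r mod d, c mod d) else 0 else 0)" if "k < d" "l < d" for k l
      using assms(2,3) lt by (subst kron_index[OF mat_basis_carrier assms(1)[OF that]])
        (auto simp: mat_basis_def)
    then show ?thesis
      unfolding choi_def msum_def using assms(2,3) by (auto intro!: sum.cong)
  qed
  also have "\<dots> = (\<Sum>k<d. if k = r div d then (\<Sum>l<d. if l = c div d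
        then \<Lambda> (mat_basis d k l) $$ (r mod d, c mod d) else 0) else 0)"
    unfolding sum.cartesian_product[symmetric] by (intro sum.cong refl) simp
  also have "\<dots> = \<Lambda> (mat_basis d (r div d) (c div d)) $$ (r mod d, c mod d)"
    using lt by simp
  finally show ?thesis .
qed

text \<open>The branches are computed only on \<open>d\<close>-by-\<open>d\<close> matrices, so they
  need not equal their closed forms as functions. Blocks and matrix units are
  \<open>d\<close>-by-\<open>d\<close>, hence complete positivity and the Choi matrix see nothing
  else.\<close>

lemma eb_cp_map_cong:
  assumes "\<And>A. A \<in> carrier_mat d d \<Longrightarrow> \<Lambda> A = \<Lambda>' A"
  shows "eb_cp_map d \<Lambda> \<longleftrightarrow> eb_cp_map d \<Lambda>'"
proof -
  have "linear_map d \<Lambda> \<longleftrightarrow> linear_map d \<Lambda>'"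
    by (simp add: linear_map_def assms)
  moreover have "id_tensor k d \<Lambda> X = id_tensor k d \<Lambda>' X" for k X
    by (simp add: id_tensor_def mat_block_def assms)
  moreover have "choi d \<Lambda> = choi d \<Lambda>'"
    by (simp add: choi_def mat_basis_def assms)
  ultimately show ?thesis
    by (simp add: eb_cp_map_def cp_map_def)
qed

text \<open>If \<open>M = \<Sum> P\<^sub>m \<otimes> Q\<^sub>m\<close> vanishes at the diagonal position \<open>(i, j)\<close>, then for each \<open>m\<close> one of
  \<open>P\<^sub>m\<close>, \<open>Q\<^sub>m\<close> has a vanishing diagonal entry there, hence a vanishing row. This is positivity of the
  partial transpose, tested on a single 2-by-2 minor.\<close>

lemma separable_zero_diag:
  assumes M: "separable d M" and lt: "i < d" "j < d" "k < d" "l < d"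
    and z: "M $$ (i * d + j, i * d + j) = 0"
  shows "M $$ (i * d + l, k * d + j) = 0"
proof -
  obtain m :: nat and P Q where PQ: "\<And>t. t < m \<Longrightarrow> psd d (P t)" "\<And>t. t < m \<Longrightarrow> psd d (Q t)"
    and Meq: "M = msum (d * d) (\<lambda>t. kron (P t) (Q t)) {..<m}"
    using M unfolding separable_def by blast
  have bound: "a * d + b < d * d" if "a < d" "b < d" for a b
  proof -
    have "a * d + b < Suc a * d" using that by simp
    also have "\<dots> \<le> d * d" using that by (intro mult_le_mono1) simp
    finally show ?thesis .
  qed
  have ent: "M $$ (a * d + b, a' * d + b') = (\<Sum>t<m. P t $$ (a, a') * Q t $$ (b, b'))"
    if "a < d" "b < d" "a' < d" "b' < d" for a b a' b'
  proof -
    have "P t \<in> carrier_mat d d" "Q t \<in> carrier_mat d d" if "t < m" for t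
      using PQ that by (auto simp: psd_def)
    then have "kron (P t) (Q t) $$ (a * d + b, a' * d + b') = P t $$ (a, a') * Q t $$ (b, b')"
      if "t < m" for t
      using that \<open>a < d\<close> \<open>b < d\<close> \<open>a' < d\<close> \<open>b' < d\<close> by (subst kron_index) (auto simp: bound)
    then show ?thesis
      unfolding Meq using that by (auto simp: msum_def bound)
  qed
  have nonneg: "0 \<le> P t $$ (i, i) * Q t $$ (j, j)" if "t < m" for t
    using psd_diag_nonneg[OF PQ(1) lt(1)] psd_diag_nonneg[OF PQ(2) lt(2)] that by simp
  have "(\<Sum>t<m. P t $$ (i, i) * Q t $$ (j, j)) = 0"
    using z ent[OF lt(1,2,1,2)] by simp
  \<comment> \<open>A vanishing sum of nonnegative terms has only zero terms.\<close>
  then have zt: "P t $$ (i, i) * Q t $$ (j, j) = 0" if "t < m" for t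
    using that nonneg by (subst (asm) sum_nonneg_eq_0_iff) auto
  \<comment> \<open>Either row \<open>i\<close> of \<open>P t\<close> vanishes, killing the first
    factor, or column \<open>j\<close> of \<open>Q t\<close> vanishes, killing the second.\<close>
  have "P t $$ (i, k) * Q t $$ (l, j) = 0" if t: "t < m" for t
    using zt[OF t] psd_zero_diag(1)[OF PQ(1)[OF t] lt(1,3)] psd_zero_diag(2)[OF PQ(2)[OF t] lt(2,4)]
    by auto
  then have "(\<Sum>t<m. P t $$ (i, k) * Q t $$ (l, j)) = 0"
    by (intro sum.neutral) auto
  then show ?thesis
    using ent[OF lt(1,4,3,2)] by simp
qed

lemma separable_zero: "separable d (0\<^sub>m (d * d) (d * d))"
  unfolding separable_def by (rule exI[of _ 0]) (auto simp: msum_def)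

text \<open>The quadratic form at \<open>f\<close> is the squared modulus of
  \<open>f k\<close>.\<close>

lemma psd_mat_basis:
  assumes "k < d"
  shows "psd d (mat_basis d k k)"
  unfolding psd_iff
proof (intro conjI allI)
  fix f :: "nat \<Rightarrow> complex"
  have "(\<Sum>i<d. \<Sum>j<d. mat_basis d k k $$ (i, j) * f j * cnj (f i)) =
    (\<Sum>i<d. if i = k then (\<Sum>j<d. if j = k then f j * cnj (f i) else 0) else 0)"
    by (intro sum.cong refl) (auto simp: mat_basis_def if_distrib[of "times _"] if_distrib[of "\<lambda>x. x * _"] cong: if_cong)
  also have "\<dots> = of_real ((cmod (f k))\<^sup>2)"
    using assms by (simp add: complex_norm_square[symmetric] del: of_real_power)
  finally show "0 \<le> (\<Sum>i<d. \<Sum>j<d. mat_basis d k k $$ (i, j) * f j * cnj (f i))"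
    by (simp add: less_eq_complex_def)
qed simp

section \<open>Evaluating the branches\<close>

lemma mat_basis_mult:
  assumes "j < d"
  shows "mat_basis d i j * mat_basis d k l = (if j = k then mat_basis d i l else 0\<^sub>m d d)"
proof (rule eq_matI)
  fix r c
  assume "r < dim_row (if j = k then mat_basis d i l else 0\<^sub>m d d)"
    "c < dim_col (if j = k then mat_basis d i l else 0\<^sub>m d d)"
  then have rc: "r < d" "c < d"
    by (auto simp: mat_basis_def split: if_splits)
  have "(mat_basis d i j * mat_basis d k l) $$ (r, c) =
    (\<Sum>m<d. if m = j then if r = i \<and> m = k \<and> c = l then 1 else 0 else 0)"
    using rc by (subst mult_index[of _ d]) (auto simp: mat_basis_def if_distrib[of "times _"] if_distrib[of "\<lambda>x. x * _"] cong: if_cong)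
  then show "(mat_basis d i j * mat_basis d k l) $$ (r, c) =
      (if j = k then mat_basis d i l else 0\<^sub>m d d) $$ (r, c)"
    using assms rc by (auto simp: mat_basis_def)
qed (auto simp: mat_basis_def)

text \<open>Reduces \<open>C\<^sub>+\<close> to the entries of the anticommutators. With the pair
  sum split in two, the formula can be evaluated by simplification on an explicit list.\<close>

lemma kraus_plus_index:
  assumes "set Ks \<subseteq> carrier_mat d d" "\<rho> \<in> carrier_mat d d" "i < d" "j < d"
  shows "kraus_plus d Ks \<rho> $$ (i, j) = 1 / 4 * (\<Sum>b<d. \<Sum>a<d. \<rho> $$ (a, b) *
    (\<Sum>x<length Ks. \<Sum>y<length Ks. anticommutator (Ks ! x) (Ks ! y) $$ (i, a) *
      cnj (anticommutator (Ks ! x) (Ks ! y) $$ (j, b))))"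
proof -
  have c: "anticommutator (Ks ! x) (Ks ! y) \<in> carrier_mat d d" if "x < length Ks" "y < length Ks" for x y
  proof -
    have "Ks ! x \<in> carrier_mat d d" "Ks ! y \<in> carrier_mat d d"
      using that assms(1) nth_mem by blast+
    then show ?thesis by (simp add: anticommutator_def)
  qed
  show ?thesis
    unfolding kraus_plus_def using assms
    by (simp add: sandwich_sum_index[OF c assms(2-4)] sum.cartesian_product[symmetric])
qed

lemma kraus_minus_commuting:
  assumes "set Ks \<subseteq> carrier_mat d d" "\<rho> \<in> carrier_mat d d"
    and comm: "\<And>A B. A \<in> set Ks \<Longrightarrow> B \<in> set Ks \<Longrightarrow> A * B = B * A"
  shows "kraus_minus d Ks \<rho> = 0\<^sub>m d d"
proof -
  have "commutator (Ks ! x) (Ks ! y) = 0\<^sub>m d d" if "x < length Ks" "y < length Ks" for x y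
  proof -
    have "Ks ! x \<in> carrier_mat d d" "Ks ! y \<in> carrier_mat d d"
      using that assms(1) nth_mem by blast+
    then have "Ks ! x * Ks ! y \<in> carrier_mat d d" by simp
    then show ?thesis
      using comm[of "Ks ! x" "Ks ! y"] that by (simp add: commutator_def)
  qed
  moreover have "0\<^sub>m d d * \<rho> * mat_adjoint (0\<^sub>m d d) = 0\<^sub>m d d"
    using assms(2) mat_adjoint_carrier[OF zero_carrier_mat, of d d]
    by (simp add: left_mult_zero_mat[OF mat_adjoint_carrier[OF zero_carrier_mat]])
  ultimately show ?thesis
    by (auto simp: kraus_minus_def msum_def intro!: eq_matI sum.neutral)
qed

section \<open>The dephasing and bit flip channels on a qubit\<close>

definition dephasing :: "complex mat \<Rightarrow> complex mat" where
  "dephasing \<rho> = mat 2 2 (\<lambda>(i, j). if i = j then \<rho> $$ (i, i) else 0)"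

text \<open>Conjugation by the Pauli matrix \<open>\<sigma>\<^sub>x\<close>; on the indices 0 and 1,
  \<open>1 - i\<close> is the other index.\<close>

definition bit_flip :: "complex mat \<Rightarrow> complex mat" where
  "bit_flip \<rho> = mat 2 2 (\<lambda>(i, j). \<rho> $$ (1 - i, 1 - j))"

lemma lessThan_2: "{..<2::nat} = {0, 1}"
  by auto

lemma mat2_eqI:
  assumes "A \<in> carrier_mat 2 2" "B \<in> carrier_mat 2 2"
    and "A $$ (0, 0) = B $$ (0, 0)" "A $$ (0, 1) = B $$ (0, 1)"
    and "A $$ (1, 0) = B $$ (1, 0)" "A $$ (1, 1) = B $$ (1, 1)"
  shows "A = B"
  using assms by (intro eq_matI) (auto simp: less_2_cases_iff)

lemma is_kraus_dephasing: "is_kraus 2 [mat_basis 2 0 0, mat_basis 2 1 1] dephasing"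
  unfolding is_kraus_def
proof (intro conjI ballI)
  fix \<rho> :: "complex mat" assume r: "\<rho> \<in> carrier_mat 2 2"
  show "dephasing \<rho> = msum 2 (\<lambda>x. [mat_basis 2 0 0, mat_basis 2 1 1] ! x * \<rho> *
      mat_adjoint ([mat_basis 2 0 0, mat_basis 2 1 1] ! x)) {..<length [mat_basis 2 0 0, mat_basis 2 1 1]}"
    using r by (intro mat2_eqI)
      (simp_all add: dephasing_def lessThan_2 mat_basis_def msum_def sandwich_index[of _ 2])
qed simp

lemma is_kraus_bit_flip: "is_kraus 2 [mat_basis 2 0 1 + mat_basis 2 1 0] bit_flip"
  unfolding is_kraus_def
proof (intro conjI ballI)
  fix \<rho> :: "complex mat" assume r: "\<rho> \<in> carrier_mat 2 2"
  show "bit_flip \<rho> = msum 2 (\<lambda>x. [mat_basis 2 0 1 + mat_basis 2 1 0] ! x * \<rho> *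
      mat_adjoint ([mat_basis 2 0 1 + mat_basis 2 1 0] ! x)) {..<length [mat_basis 2 0 1 + mat_basis 2 1 0]}"
    using r by (intro mat2_eqI)
      (simp_all add: bit_flip_def lessThan_2 mat_basis_def msum_def sandwich_index[of _ 2])
qed simp

text \<open>Multiplying the two projections from the left by \<open>\<sigma>\<^sub>x\<close> turns
  \<open>|0><0|\<close> into \<open>|1><0|\<close> and \<open>|1><1|\<close> into
  \<open>|0><1|\<close>.\<close>

lemma is_kraus_bit_flip_dephasing:
  "is_kraus 2 [mat_basis 2 1 0, mat_basis 2 0 1] (bit_flip \<circ> dephasing)"
  unfolding is_kraus_def
proof (intro conjI ballI)
  fix \<rho> :: "complex mat" assume r: "\<rho> \<in> carrier_mat 2 2"
  show "(bit_flip \<circ> dephasing) \<rho> = msum 2 (\<lambda>x. [mat_basis 2 1 0, mat_basis 2 0 1] ! x * \<rho> *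
      mat_adjoint ([mat_basis 2 1 0, mat_basis 2 0 1] ! x)) {..<length [mat_basis 2 1 0, mat_basis 2 0 1]}"
    using r by (intro mat2_eqI)
      (simp_all add: bit_flip_def dephasing_def lessThan_2 mat_basis_def msum_def sandwich_index[of _ 2])
qed simp

lemma quantum_channel_dephasing: "quantum_channel 2 dephasing"
  unfolding quantum_channel_def trace_preserving_def
  using is_kraus_imp_cp_map[OF is_kraus_dephasing]
  by (auto simp: mat_trace_def dephasing_def lessThan_2)

lemma quantum_channel_bit_flip: "quantum_channel 2 bit_flip"
  unfolding quantum_channel_def trace_preserving_def
  using is_kraus_imp_cp_map[OF is_kraus_bit_flip]
  by (auto simp: mat_trace_def bit_flip_def lessThan_2)

text \<open>The Choi matrix is \<open>|00><00| + |11><11|\<close>, a sum of two product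
  projections.\<close>

lemma eb_cp_map_dephasing: "eb_cp_map 2 dephasing"
proof -
  have car: "dephasing A \<in> carrier_mat 2 2" for A
    by (simp add: dephasing_def)
  have "choi 2 dephasing = msum (2 * 2) (\<lambda>t. kron (mat_basis 2 t t) (mat_basis 2 t t)) {..<2}"
  proof (rule eq_matI)
    fix r c :: nat
    assume "r < dim_row (msum (2 * 2) (\<lambda>t. kron (mat_basis 2 t t) (mat_basis 2 t t)) {..<2})"
      "c < dim_col (msum (2 * 2) (\<lambda>t. kron (mat_basis 2 t t) (mat_basis 2 t t)) {..<2})"
    then have rc: "r < 2 * 2" "c < 2 * 2"
      by (simp_all add: msum_def)
    then have "r div 2 < 2" "c div 2 < 2"
      by auto
    moreover have "r mod 2 < 2" "c mod 2 < 2"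
      by simp_all
    ultimately show "choi 2 dephasing $$ (r, c) =
        msum (2 * 2) (\<lambda>t. kron (mat_basis 2 t t) (mat_basis 2 t t)) {..<2} $$ (r, c)"
      using rc by (subst choi_index[OF car])
        (auto simp: msum_def kron_index[of _ 2] lessThan_2 dephasing_def mat_basis_def)
  qed (simp_all add: choi_def msum_def)
  moreover have "separable 2 \<dots>"
    unfolding separable_def
    by (rule exI[of _ 2], rule exI[of _ "\<lambda>t. mat_basis 2 t t"], rule exI[of _ "\<lambda>t. mat_basis 2 t t"])
      (simp add: psd_mat_basis)
  ultimately show ?thesis
    using is_kraus_imp_cp_map[OF is_kraus_dephasing] by (simp add: eb_cp_map_def)
qed

lemma branch_plus_dephasing:
  assumes r: "\<rho> \<in> carrier_mat 2 2"
  shows "branch_plus 2 dephasing \<rho> = dephasing \<rho>"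
proof -
  let ?E = "mat_basis 2"
  \<comment> \<open>Mixed pairs contribute nothing. Each equal pair carries a factor 2 on both sides
    of the argument, and the resulting 4 cancels the prefactor 1/4.\<close>
  have "anticommutator (?E 0 0) (?E 0 0) = 2 \<cdot>\<^sub>m ?E 0 0" "anticommutator (?E 1 1) (?E 1 1) = 2 \<cdot>\<^sub>m ?E 1 1"
    "anticommutator (?E 0 0) (?E 1 1) = 0\<^sub>m 2 2" "anticommutator (?E 1 1) (?E 0 0) = 0\<^sub>m 2 2"
    by (simp_all add: anticommutator_def mat_basis_mult) (auto simp: mat_basis_def intro!: eq_matI)
  then have "kraus_plus 2 [?E 0 0, ?E 1 1] \<rho> $$ (i, j) = dephasing \<rho> $$ (i, j)" if "i < 2" "j < 2" for i j
    using r that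
    by (simp add: kraus_plus_index) (auto simp: lessThan_2 dephasing_def mat_basis_def less_2_cases_iff)
  then have "kraus_plus 2 [?E 0 0, ?E 1 1] \<rho> = dephasing \<rho>"
    by (intro eq_matI) (simp_all add: dephasing_def kraus_plus_def)
  then show ?thesis
    by (simp add: branch_eq(1)[OF is_kraus_dephasing r])
qed

lemma branch_minus_dephasing:
  assumes "\<rho> \<in> carrier_mat 2 2"
  shows "branch_minus 2 dephasing \<rho> = 0\<^sub>m 2 2"
  unfolding branch_eq(2)[OF is_kraus_dephasing assms]
  by (rule kraus_minus_commuting) (use assms in \<open>auto simp: mat_basis_mult\<close>)

lemma branch_plus_bit_flip_dephasing:
  assumes r: "\<rho> \<in> carrier_mat 2 2"
  shows "branch_plus 2 (bit_flip \<circ> dephasing) \<rho> = (1 / 2) \<cdot>\<^sub>m \<rho>"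
proof -
  let ?E = "mat_basis 2"
  \<comment> \<open>Both operators square to zero, while each of the two ordered mixed pairs
    contributes the identity map; two times 1/4 gives the factor 1/2.\<close>
  have "anticommutator (?E 1 0) (?E 1 0) = 0\<^sub>m 2 2" "anticommutator (?E 0 1) (?E 0 1) = 0\<^sub>m 2 2"
    "anticommutator (?E 1 0) (?E 0 1) = 1\<^sub>m 2" "anticommutator (?E 0 1) (?E 1 0) = 1\<^sub>m 2"
    by (simp_all add: anticommutator_def mat_basis_mult) (auto simp: mat_basis_def intro!: eq_matI)
  then have "kraus_plus 2 [?E 1 0, ?E 0 1] \<rho> $$ (i, j) = ((1 / 2) \<cdot>\<^sub>m \<rho>) $$ (i, j)"
    if "i < 2" "j < 2" for i j
    using r that
    by (simp add: kraus_plus_index) (auto simp: lessThan_2 less_2_cases_iff)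
  then have "kraus_plus 2 [?E 1 0, ?E 0 1] \<rho> = (1 / 2) \<cdot>\<^sub>m \<rho>"
    using r by (intro eq_matI) (simp_all add: kraus_plus_def)
  then show ?thesis
    by (simp add: branch_eq(1)[OF is_kraus_bit_flip_dephasing r])
qed

section \<open>The zero map and multiples of the identity map\<close>

lemma eb_cp_map_zero: "eb_cp_map d (\<lambda>_. 0\<^sub>m d d)"
proof -
  have "is_kraus d [] (\<lambda>_. 0\<^sub>m d d)"
    by (auto simp: is_kraus_def msum_def)
  moreover have "choi d (\<lambda>_. 0\<^sub>m d d) = 0\<^sub>m (d * d) (d * d)"
  proof (rule eq_matI)
    fix r c assume "r < dim_row (0\<^sub>m (d * d) (d * d))" "c < dim_col (0\<^sub>m (d * d) (d * d))"
    then have rc: "r < d * d" "c < d * d"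
      by simp_all
    \<comment> \<open>Ensures that \<open>r mod d\<close> and \<open>c mod d\<close> are valid
      indices of the zero matrix.\<close>
    then have "0 < d"
      by (cases d) auto
    then show "choi d (\<lambda>_. 0\<^sub>m d d) $$ (r, c) = 0\<^sub>m (d * d) (d * d) $$ (r, c)"
      using rc by (simp add: choi_index)
  qed (simp_all add: choi_def msum_def)
  ultimately show ?thesis
    using is_kraus_imp_cp_map separable_zero by (simp add: eb_cp_map_def)
qed

text \<open>The Choi matrix is \<open>c\<close> times the unnormalised maximally entangled
  projection. It vanishes at the diagonal position \<open>(0, 1)\<close> but has the entry
  \<open>c\<close> between \<open>(0, 0)\<close> and \<open>(1, 1)\<close>, which
  \<open>separable_zero_diag\<close> rules out.\<close>

lemma not_eb_scaled_identity:
  assumes "c \<noteq> 0" and d: "2 \<le> d"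
  shows "\<not> eb_cp_map d (\<lambda>\<rho>. c \<cdot>\<^sub>m \<rho>)"
proof
  let ?C = "choi d (\<lambda>\<rho>. c \<cdot>\<^sub>m \<rho>)"
  assume "eb_cp_map d (\<lambda>\<rho>. c \<cdot>\<^sub>m \<rho>)"
  then have sep: "separable d ?C"
    by (simp add: eb_cp_map_def)
  have lt: "1 < d" "1 < d * d" "d + 1 < d * d"
  proof -
    show "1 < d" using d by simp
    have "d + 1 < 2 * d" using d by simp
    also have "\<dots> \<le> d * d" using d by (intro mult_le_mono1)
    finally show "d + 1 < d * d" .
    then show "1 < d * d" by simp
  qed
  \<comment> \<open>\<open>Suc d\<close> is the simplified form of the position
    \<open>1 * d + 1\<close>, which encodes \<open>(1, 1)\<close>.\<close>
  have dm: "Suc d mod d = 1" "Suc d div d = 1"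
    using d mod_mult_self1[of 1 1 d] div_mult_self1[of d 1 1] by simp_all
  have "?C $$ (0 * d + 1, 0 * d + 1) = 0"
    using lt by (subst choi_index) (auto simp: mat_basis_def)
  \<comment> \<open>Here \<open>i = 0\<close>, \<open>j = 1\<close>, \<open>k = 1\<close> and
    \<open>l = 0\<close>; the rotation brings the premise on the zero diagonal entry to the
    front.\<close>
  then have "?C $$ (0 * d + 0, 1 * d + 1) = 0"
    by (rule separable_zero_diag[OF sep, rotated -1]) (use lt in auto)
  moreover have "?C $$ (0 * d + 0, 1 * d + 1) = c"
    using lt by (subst choi_index) (auto simp: mat_basis_def dm)
  ultimately show False
    using assms by simp
qed

theorem mainTheorem2:
  shows "\<exists>(d::nat) (\<Lambda> :: complex mat \<Rightarrow> complex mat) (\<Phi> :: complex mat \<Rightarrow> complex mat).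
    0 < d \<and> quantum_channel d \<Lambda> \<and> quantum_channel d \<Phi> \<and>
    (eb_channel d \<Lambda> \<and> eb_cp_map d (branch_plus d \<Lambda>) \<and> eb_cp_map d (branch_minus d \<Lambda>)) \<and>
    (\<not> eb_cp_map d (branch_plus d (\<Phi> \<circ> \<Lambda>)) \<or> \<not> eb_cp_map d (branch_minus d (\<Phi> \<circ> \<Lambda>)))"
proof (rule exI[of _ 2], rule exI[of _ dephasing], rule exI[of _ bit_flip], intro conjI disjI1)
  show "eb_channel 2 dephasing"
    using quantum_channel_dephasing eb_cp_map_dephasing by (simp add: eb_channel_def)
  show "eb_cp_map 2 (branch_plus 2 dephasing)"
    using eb_cp_map_cong[OF branch_plus_dephasing] eb_cp_map_dephasing by simp
  show "eb_cp_map 2 (branch_minus 2 dephasing)"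
    using eb_cp_map_cong[OF branch_minus_dephasing] eb_cp_map_zero by simp
  show "\<not> eb_cp_map 2 (branch_plus 2 (bit_flip \<circ> dephasing))"
    using eb_cp_map_cong[OF branch_plus_bit_flip_dephasing] not_eb_scaled_identity[of "1 / 2" 2]
    by simp
qed (simp_all add: quantum_channel_dephasing quantum_channel_bit_flip)

end
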